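(* Let $A$ be a Banach algebra, $E$ a Banach left $A$-module, $\phi\in\Delta(A)$, and $J$ a closed ideal of $A$ such that $\phi|_{J}\neq 0$. Regard $E$ also as a Banach left $J$-module by restricting the action. (i) Suppose that $J$ has an identity $e_J$ and that $E$ is a unital Banach left $J$-module. If $E$ is $\phi$-injective as a Banach left $A$-module, then $E$ is $\phi|_{J}$-injective as a (unital) Banach left $J$-module. (ii) If $E$ is $\phi|_{J}$-injective as a Banach left $J$-module and is faithful as a Banach left $J$-module, then $E$ is $\phi$-injective as a Banach left $A$-module.
   Context: $\Delta(A)$ is the set of characters of the Banach algebra $A$, i.e. non-zero (algebra) homomorphisms $A\to\mathbb{C}$. For Banach left $A$-modules $F,K$, $_{A}B(F,K)$ is the space of bounded linear left $A$-module morphisms $F\to K$. A bounded linear operator $T:F\to K$ is admissible if $\ker T$ and $\operatorname{Im}T$ are closed complemented subspaces of $F$ and $K$ respectively (equivalently, there is a bounded linear $S:K\to F$ with $T\circ S\circ T=T$). A monomorphism is an injective bounded module morphism. For a Banach left $A$-module $K$ and $\phi\in\Delta(A)$, $I(\phi,K)=\operatorname{span}\{a\cdot x-\phi(a)x : a\in A,\ x\in K\}$. A Banach left $A$-module $E$ is $\phi$-injective if for all Banach left $A$-modules $F,K$ and every admissible monomorphism $T\in{}_{A}B(F,K)$ with $I(\phi,K)\subseteq\operatorname{Im}T$, the map $_{A}B(K,E)\to{}_{A}B(F,E)$, $R\mapsto R\circ T$, is onto. The same definition is applied with $J$ and $\phi|_J\in\Delta(J)$ in place of $A$ and $\phi$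 (with test modules $F,K$ ranging over all Banach left $J$-modules). "Ideal" means two-sided ideal. $E$ is a unital left $J$-module if $e_J\cdot x=x$ for all $x\in E$. A Banach left $J$-module $E$ is faithful if $J\cdot x=\{0\}$ implies $x=0$, for $x\in E$. *)

theory Defs
  imports
    "HOL-Analysis.Analysis"
    "HOL-Algebra.Module"
    "HOL-Algebra.AbelCoset"
    "HOL-Algebra.Algebraic_Closure_Type"
begin

section \<open>Complex Banach spaces with an explicit carrier\<close>

text \<open>
  Everything is carrier-based, so that a definition can quantify over all Banach modules whose
  underlying set is a subset of a given type, and so that a closed ideal is itself a Banach algebra.
  Vector spaces are modules in the sense of HOL-Algebra over the field of complex numbers. As usual
  there, the inherited fields \<open>mult\<close> and \<open>one\<close> play no role for modules; an algebra uses \<open>mult\<close> as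
  its product and ignores \<open>one\<close> (Banach algebras need not be unital).
\<close>

abbreviation complex_ring :: "complex ring"
  where "complex_ring \<equiv> ring_of_type_algebra"

record 'v cnormed = "(complex, 'v) module" +
  vnorm :: "'v \<Rightarrow> real"  (\<open>\<parallel>_\<parallel>\<index>\<close>)

text \<open>The distance is cut off outside the carrier because the locale \<open>Metric_space\<close> demands
  nonnegativity and symmetry on the whole type.\<close>

definition vdist :: "('v, 'm) cnormed_scheme \<Rightarrow> 'v \<Rightarrow> 'v \<Rightarrow> real"
  where "vdist V x y = (if x \<in> carrier V \<and> y \<in> carrier V then \<parallel>x \<ominus>\<^bsub>V\<^esub> y\<parallel>\<^bsub>V\<^esub> else 0)"

locale complex_banach_space = module complex_ring V for V :: "('v, 'm) cnormed_scheme" (structure) +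
  assumes norm_nonneg: "x \<in> carrier V \<Longrightarrow> 0 \<le> \<parallel>x\<parallel>"
    and norm_eq_zero: "x \<in> carrier V \<Longrightarrow> \<parallel>x\<parallel> = 0 \<longleftrightarrow> x = \<zero>"
    and norm_triangle: "\<lbrakk>x \<in> carrier V; y \<in> carrier V\<rbrakk> \<Longrightarrow> \<parallel>x \<oplus> y\<parallel> \<le> \<parallel>x\<parallel> + \<parallel>y\<parallel>"
    and norm_smult: "x \<in> carrier V \<Longrightarrow> \<parallel>c \<odot> x\<parallel> = cmod c * \<parallel>x\<parallel>"
    and complete: "Metric_space.mcomplete (carrier V) (vdist V)"

definition closed_subspace :: "('v, 'm) cnormed_scheme \<Rightarrow> 'v set \<Rightarrow> bool"
  where "closed_subspace V H \<longleftrightarrow>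
    submodule H complex_ring V \<and> closedin (Metric_space.mtopology (carrier V) (vdist V)) H"

definition closed_complemented_subspace :: "('v, 'm) cnormed_scheme \<Rightarrow> 'v set \<Rightarrow> bool"
  where "closed_complemented_subspace V H \<longleftrightarrow>
    closed_subspace V H \<and>
    (\<exists>H'. closed_subspace V H' \<and> H \<inter> H' = {\<zero>\<^bsub>V\<^esub>} \<and> H <+>\<^bsub>V\<^esub> H' = carrier V)"

definition bounded_linear_maps ::
    "('v, 'm) cnormed_scheme \<Rightarrow> ('w, 'n) cnormed_scheme \<Rightarrow> ('v \<Rightarrow> 'w) set"
  where "bounded_linear_maps V W =
    {T \<in> carrier V \<rightarrow> carrier W.
      (\<forall>x\<in>carrier V. \<forall>y\<in>carrier V. T (x \<oplus>\<^bsub>V\<^esub> y) = T x \<oplus>\<^bsub>W\<^esub> T y) \<and>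
      (\<forall>c. \<forall>x\<in>carrier V. T (c \<odot>\<^bsub>V\<^esub> x) = c \<odot>\<^bsub>W\<^esub> T x) \<and>
      (\<exists>C. \<forall>x\<in>carrier V. \<parallel>T x\<parallel>\<^bsub>W\<^esub> \<le> C * \<parallel>x\<parallel>\<^bsub>V\<^esub>)}"

definition admissible ::
    "('v, 'm) cnormed_scheme \<Rightarrow> ('w, 'n) cnormed_scheme \<Rightarrow> ('v \<Rightarrow> 'w) \<Rightarrow> bool"
  where "admissible V W T \<longleftrightarrow>
    T \<in> bounded_linear_maps V W \<and>
    closed_complemented_subspace V (a_kernel V W T) \<and>
    closed_complemented_subspace W (T ` carrier V)"


section \<open>Banach algebras, closed ideals and characters\<close>

locale complex_banach_algebra = complex_banach_space A for A :: "('a, 'm) cnormed_scheme" (structure) +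
  assumes mult_closed: "\<lbrakk>a \<in> carrier A; b \<in> carrier A\<rbrakk> \<Longrightarrow> a \<otimes> b \<in> carrier A"
    and mult_assoc: "\<lbrakk>a \<in> carrier A; b \<in> carrier A; c \<in> carrier A\<rbrakk> \<Longrightarrow>
      (a \<otimes> b) \<otimes> c = a \<otimes> (b \<otimes> c)"
    and mult_distrib_right: "\<lbrakk>a \<in> carrier A; b \<in> carrier A; c \<in> carrier A\<rbrakk> \<Longrightarrow>
      (a \<oplus> b) \<otimes> c = a \<otimes> c \<oplus> b \<otimes> c"
    and mult_distrib_left: "\<lbrakk>a \<in> carrier A; b \<in> carrier A; c \<in> carrier A\<rbrakk> \<Longrightarrow>
      a \<otimes> (b \<oplus> c) = a \<otimes> b \<oplus> a \<otimes> c"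
    and mult_smult_left: "\<lbrakk>a \<in> carrier A; b \<in> carrier A\<rbrakk> \<Longrightarrow>
      (z \<odot> a) \<otimes> b = z \<odot> (a \<otimes> b)"
    and mult_smult_right: "\<lbrakk>a \<in> carrier A; b \<in> carrier A\<rbrakk> \<Longrightarrow>
      a \<otimes> (z \<odot> b) = z \<odot> (a \<otimes> b)"
    and norm_mult: "\<lbrakk>a \<in> carrier A; b \<in> carrier A\<rbrakk> \<Longrightarrow> \<parallel>a \<otimes> b\<parallel> \<le> \<parallel>a\<parallel> * \<parallel>b\<parallel>"

definition closed_ideal :: "('a, 'm) cnormed_scheme \<Rightarrow> 'a set \<Rightarrow> bool"
  where "closed_ideal A J \<longleftrightarrow>
    closed_subspace A J \<and>
    (\<forall>a\<in>carrier A. \<forall>j\<in>J. a \<otimes>\<^bsub>A\<^esub> j \<in> J \<and> j \<otimes>\<^bsub>A\<^esub> a \<in> J)"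

definition is_identity :: "('a, 'm) cnormed_scheme \<Rightarrow> 'a \<Rightarrow> bool"
  where "is_identity A e \<longleftrightarrow>
    e \<in> carrier A \<and> (\<forall>a\<in>carrier A. e \<otimes>\<^bsub>A\<^esub> a = a \<and> a \<otimes>\<^bsub>A\<^esub> e = a)"

text \<open>Only the values on the carrier matter. Continuity is automatic and not part of the
  definition.\<close>

definition characters :: "('a, 'm) cnormed_scheme \<Rightarrow> ('a \<Rightarrow> complex) set"  (\<open>\<Delta>\<close>)
  where "\<Delta> A = {\<phi>.
    (\<forall>a\<in>carrier A. \<forall>b\<in>carrier A. \<phi> (a \<oplus>\<^bsub>A\<^esub> b) = \<phi> a + \<phi> b) \<and>
    (\<forall>z. \<forall>a\<in>carrier A. \<phi> (z \<odot>\<^bsub>A\<^esub> a) = z * \<phi> a) \<and>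
    (\<forall>a\<in>carrier A. \<forall>b\<in>carrier A. \<phi> (a \<otimes>\<^bsub>A\<^esub> b) = \<phi> a * \<phi> b) \<and>
    (\<exists>a\<in>carrier A. \<phi> a \<noteq> 0)}"


section \<open>Banach left modules\<close>

record ('a, 'v) left_module = "'v cnormed" +
  act :: "'a \<Rightarrow> 'v \<Rightarrow> 'v"  (infixl \<open>\<cdot>\<index>\<close> 70)

text \<open>The action is jointly continuous, with some constant; contractivity of the action could be
  achieved by an equivalent renorming.\<close>

locale banach_left_module =
  alg: complex_banach_algebra A + complex_banach_space E
  for A :: "('a, 'm) cnormed_scheme" and E :: "('a, 'v, 'n) left_module_scheme" (structure) +
  assumes act_closed: "\<lbrakk>a \<in> carrier A; x \<in> carrier E\<rbrakk> \<Longrightarrow> a \<cdot> x \<in> carrier E"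
    and act_add_left: "\<lbrakk>a \<in> carrier A; b \<in> carrier A; x \<in> carrier E\<rbrakk> \<Longrightarrow>
      (a \<oplus>\<^bsub>A\<^esub> b) \<cdot> x = a \<cdot> x \<oplus> b \<cdot> x"
    and act_add_right: "\<lbrakk>a \<in> carrier A; x \<in> carrier E; y \<in> carrier E\<rbrakk> \<Longrightarrow>
      a \<cdot> (x \<oplus> y) = a \<cdot> x \<oplus> a \<cdot> y"
    and act_smult_left: "\<lbrakk>a \<in> carrier A; x \<in> carrier E\<rbrakk> \<Longrightarrow> (z \<odot>\<^bsub>A\<^esub> a) \<cdot> x = z \<odot> (a \<cdot> x)"
    and act_smult_right: "\<lbrakk>a \<in> carrier A; x \<in> carrier E\<rbrakk> \<Longrightarrow> a \<cdot> (z \<odot> x) = z \<odot> (a \<cdot> x)"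
    and act_mult: "\<lbrakk>a \<in> carrier A; b \<in> carrier A; x \<in> carrier E\<rbrakk> \<Longrightarrow>
      (a \<otimes>\<^bsub>A\<^esub> b) \<cdot> x = a \<cdot> (b \<cdot> x)"
    and act_bounded: "\<exists>C. \<forall>a\<in>carrier A. \<forall>x\<in>carrier E. \<parallel>a \<cdot> x\<parallel> \<le> C * \<parallel>a\<parallel>\<^bsub>A\<^esub> * \<parallel>x\<parallel>"

definition bounded_module_maps ::
    "('a, 'm) cnormed_scheme \<Rightarrow> ('a, 'v, 'n) left_module_scheme \<Rightarrow>
     ('a, 'w, 'k) left_module_scheme \<Rightarrow> ('v \<Rightarrow> 'w) set"
  where "bounded_module_maps A F K =
    {T \<in> bounded_linear_maps F K. \<forall>a\<in>carrier A. \<forall>x\<in>carrier F. T (a \<cdot>\<^bsub>F\<^esub> x) = a \<cdot>\<^bsub>K\<^esub> T x}"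

definition unital_action :: "'a \<Rightarrow> ('a, 'v, 'n) left_module_scheme \<Rightarrow> bool"
  where "unital_action e E \<longleftrightarrow> (\<forall>x\<in>carrier E. e \<cdot>\<^bsub>E\<^esub> x = x)"

definition faithful_module ::
    "('a, 'm) cnormed_scheme \<Rightarrow> ('a, 'v, 'n) left_module_scheme \<Rightarrow> bool"
  where "faithful_module A E \<longleftrightarrow>
    (\<forall>x\<in>carrier E. (\<forall>a\<in>carrier A. a \<cdot>\<^bsub>E\<^esub> x = \<zero>\<^bsub>E\<^esub>) \<longrightarrow> x = \<zero>\<^bsub>E\<^esub>)"

text \<open>The algebraic (not closed) linear span.\<close>

definition char_span ::
    "('a, 'm) cnormed_scheme \<Rightarrow> ('a \<Rightarrow> complex) \<Rightarrow> ('a, 'v, 'n) left_module_scheme \<Rightarrow> 'v set"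
  where "char_span A \<phi> K =
    (\<lambda>H. submodule H complex_ring K) hull
      {a \<cdot>\<^bsub>K\<^esub> x \<ominus>\<^bsub>K\<^esub> \<phi> a \<odot>\<^bsub>K\<^esub> x | a x. a \<in> carrier A \<and> x \<in> carrier K}"


section \<open>Injectivity relative to a character\<close>

text \<open>
  HOL cannot quantify over types inside a formula, so the underlying sets of the test modules
  \<open>F\<close> and \<open>K\<close> range over the subsets of a type \<open>'u\<close>, the universe, an explicit parameter;
  operations, norm and action are arbitrary. Injectivity in the absolute sense is this property
  for every type \<open>'u\<close>, and a theorem passing from this property of one module to this property of
  another in the same arbitrary universe entails the corresponding absolute statement.
\<close>

definition phi_injective ::
    "'u itself \<Rightarrow> 'a cnormed \<Rightarrow> ('a \<Rightarrow> complex) \<Rightarrow> ('a, 'e) left_module \<Rightarrow> bool"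
  where "phi_injective (U :: 'u itself) A \<phi> E \<longleftrightarrow>
    banach_left_module A E \<and>
    (\<forall>(F :: ('a, 'u) left_module) (K :: ('a, 'u) left_module) T.
      banach_left_module A F \<longrightarrow> banach_left_module A K \<longrightarrow>
      T \<in> bounded_module_maps A F K \<longrightarrow> inj_on T (carrier F) \<longrightarrow> admissible F K T \<longrightarrow>
      char_span A \<phi> K \<subseteq> T ` carrier F \<longrightarrow>
      (\<forall>Q\<in>bounded_module_maps A F E. \<exists>R\<in>bounded_module_maps A K E.
        \<forall>x\<in>carrier F. R (T x) = Q x))"

end

theory Submission
  imports Defs
begin

text \<open>
  (ii) Test data over \<open>A\<close> restrict to test data over \<open>J\<close>. A \<open>J\<close>-linear extension \<open>R\<close> is automatically
  \<open>A\<close>-linear: both \<open>j \<cdot> R (a \<cdot> x)\<close> and \<open>j \<cdot> (a \<cdot> R x)\<close> equal \<open>R ((j a) \<cdot> x)\<close>, and faithfulness cancels \<open>j\<close>.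

  (i) Test modules over \<open>J\<close> become \<open>A\<close>-modules under \<open>(a, x) \<mapsto> (a e) \<cdot> x\<close>, which is associative because
  \<open>e a e = a e\<close>. No unitality of the test modules is needed: since \<open>\<phi> (a e) = \<phi> a\<close>, each generator
  \<open>(a e) \<cdot> x - \<phi> a x\<close> of the span over \<open>A\<close> is already a generator of the span over \<open>J\<close>.
\<close>

section \<open>Replacing the action of a module\<close>

text \<open>A module given a new action is a new record. This rule and the next ones carry the
  metric, subspace and operator notions over to it, since they depend only on the normed space
  underneath.\<close>

lemma vdist_act_update [simp]:
  fixes F :: "('a, 'v, 'n) left_module_scheme"
  shows "vdist (F\<lparr>act := g\<rparr>) = vdist F"
  by (intro ext) (simp add: vdist_def a_minus_def a_inv_def)

lemma submodule_act_update [simp]: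
  fixes F :: "('a, 'v, 'n) left_module_scheme"
  shows "submodule H R (F\<lparr>act := g\<rparr>) = submodule H R F"
  by (simp add: submodule_def submodule_axioms_def subgroup_def)

lemma closed_complemented_subspace_act_update [simp]:
  fixes F :: "('a, 'v, 'n) left_module_scheme"
  shows "closed_complemented_subspace (F\<lparr>act := g\<rparr>) H = closed_complemented_subspace F H"
  by (simp add: closed_complemented_subspace_def closed_subspace_def set_add_def set_mult_def)

lemma bounded_linear_maps_act_update [simp]:
  fixes F :: "('a, 'v, 'n) left_module_scheme" and K :: "('b, 'w, 'k) left_module_scheme"
  shows "bounded_linear_maps (F\<lparr>act := g\<rparr>) W = bounded_linear_maps F W"
    and "bounded_linear_maps V (K\<lparr>act := h\<rparr>) = bounded_linear_maps V K"
  by (simp_all add: bounded_linear_maps_def)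

lemma admissible_act_update [simp]:
  fixes F :: "('a, 'v, 'n) left_module_scheme" and K :: "('b, 'w, 'k) left_module_scheme"
  shows "admissible (F\<lparr>act := g\<rparr>) (K\<lparr>act := h\<rparr>) T = admissible F K T"
  by (simp add: admissible_def a_kernel_def')

lemma complex_banach_space_act_update [simp]:
  fixes F :: "('a, 'v, 'n) left_module_scheme"
  shows "complex_banach_space (F\<lparr>act := g\<rparr>) = complex_banach_space F"
  by (simp add: complex_banach_space_def complex_banach_space_axioms_def module_def
      module_axioms_def abelian_group_def abelian_monoid_def abelian_group_axioms_def)

section \<open>The norm metric and closed subspaces\<close>

context complex_banach_space
begin

text \<open>Turns negation into a scalar multiple, so that homogeneity of the norm and of module
  actions applies to differences.\<close>

lemma smult_minus_one:
  assumes "x \<in> carrier V"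
  shows "(-1) \<odot> x = \<ominus> x"
proof -
  have "(-1) \<odot> x \<oplus> x = ((-1) \<oplus>\<^bsub>complex_ring\<^esub> 1) \<odot> x"
    using smult_l_distr[of "-1" 1 x] smult_one[of x] assms by (simp add: ring_of_type_algebra_def)
  also have "\<dots> = \<zero>"
    using smult_l_null[OF assms] by (simp add: ring_of_type_algebra_def)
  finally show ?thesis
    using assms by (intro M.minus_equality[symmetric]) (auto simp: ring_of_type_algebra_def)
qed

lemma minus_eq_zero_iff:
  assumes "x \<in> carrier V" "y \<in> carrier V"
  shows "x \<ominus> y = \<zero> \<longleftrightarrow> x = y"
  using M.add.inv_solve_right'[of \<zero> x y] assms by (auto simp: a_minus_def a_inv_def)

lemma Metric_space_vdist: "Metric_space (carrier V) (vdist V)"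
proof
  fix x y
  show "0 \<le> vdist V x y"
    by (simp add: vdist_def norm_nonneg)
  show "vdist V x y = vdist V y x"
  proof (cases "x \<in> carrier V \<and> y \<in> carrier V")
    case True
    \<comment> \<open>Symmetry of the distance is homogeneity of the norm at the scalar -1, which
      has modulus 1.\<close>
    then have "y \<ominus> x = (-1) \<odot> (x \<ominus> y)"
      by (simp add: smult_minus_one a_minus_def M.minus_add M.add.m_comm)
    with True show ?thesis
      using norm_smult[of "x \<ominus> y" "-1"] by (simp add: vdist_def)
  qed (auto simp: vdist_def)
next
  fix x y assume "x \<in> carrier V" "y \<in> carrier V"
  then show "(vdist V x y = 0) = (x = y)"
    by (simp add: vdist_def norm_eq_zero minus_eq_zero_iff)
next
  fix x y z assume "x \<in> carrier V" "y \<in> carrier V" "z \<in> carrier V"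
  moreover from this have "x \<ominus> z = (x \<ominus> y) \<oplus> (y \<ominus> z)"
    by (simp add: a_minus_def M.add.m_assoc M.r_neg1)
  ultimately show "vdist V x z \<le> vdist V x y + vdist V y z"
    by (simp add: vdist_def norm_triangle)
qed

text \<open>The additive inverse is a definite description over the carrier, so shrinking the
  carrier could change it. Inverses in a subgroup agree with those of the whole group.\<close>

lemma a_minus_submodule:
  assumes "submodule H complex_ring V" "x \<in> H" "y \<in> H"
  shows "x \<ominus>\<^bsub>V\<lparr>carrier := H\<rparr>\<^esub> y = x \<ominus> y"
proof -
  have "\<ominus>\<^bsub>V\<lparr>carrier := H\<rparr>\<^esub> y = \<ominus> y"
    using M.add.m_inv_consistent[of H y] assms 
    by (simp add: a_inv_def submodule_def)
  then show ?thesis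
    by (simp add: a_minus_def)
qed

text \<open>A closed subset of a complete metric space is complete; the algebraic laws and those of
  the norm are inherited.\<close>

lemma closed_subspace_complex_banach_space:
  assumes "closed_subspace V H"
  shows "complex_banach_space (V\<lparr>carrier := H\<rparr>)"
proof -
  have sub: "submodule H complex_ring V"
    and closed: "closedin (Metric_space.mtopology (carrier V) (vdist V)) H"
    using assms by (auto simp: closed_subspace_def)
  have HV: "H \<subseteq> carrier V"
    by (rule submoduleE(1)[OF sub])
  interpret met: Metric_space "carrier V" "vdist V"
    by (rule Metric_space_vdist)
  interpret sub: Submetric "carrier V" "vdist V" H
    by unfold_locales (rule HV)
  interpret N: module complex_ring "V\<lparr>carrier := H\<rparr>"
    by (rule submodule.submodule_is_module[OF sub module_axioms])
  \<comment> \<open>The distance of the subspace vanishes off \<open>H\<close>, so it equals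
    \<open>vdist V\<close> on \<open>H\<close> but need not be the same function.\<close>
  have dist: "vdist (V\<lparr>carrier := H\<rparr>) x y = (if x \<in> H \<and> y \<in> H then vdist V x y else 0)" for x y
    using HV a_minus_submodule[OF sub, of x y] by (auto simp: vdist_def)
  have met': "Metric_space H (vdist (V\<lparr>carrier := H\<rparr>))"
    by unfold_locales (auto simp: dist sub.sub.commute sub.sub.triangle)
  have "sub.sub.mcomplete"
    using sub.closedin_eq_mcomplete closed complete by blast
  then have "Metric_space.mcomplete H (vdist (V\<lparr>carrier := H\<rparr>))"
    \<comment> \<open>Cauchy sequences and their limits evaluate the distance only at points of
      \<open>H\<close>, where both distances agree, so completeness transfers.\<close>
    unfolding sub.sub.mcomplete_def Metric_space.mcomplete_def[OF met']
      sub.sub.MCauchy_def Metric_space.MCauchy_def[OF met']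
      sub.sub.limit_metric_sequentially Metric_space.limit_metric_sequentially[OF met']
    by (simp add: dist image_subset_iff cong: conj_cong)
  then show ?thesis
    using subsetD[OF HV] by unfold_locales
      (simp_all add: norm_nonneg norm_eq_zero norm_triangle norm_smult)
qed

end


section \<open>Closed ideals as Banach algebras and restriction of scalars\<close>

text \<open>Closedness gives completeness, and absorption gives closure under the product.\<close>

lemma closed_ideal_complex_banach_algebra:
  assumes "complex_banach_algebra A" "closed_ideal A J"
  shows "complex_banach_algebra (A\<lparr>carrier := J\<rparr>)"
proof -
  interpret A: complex_banach_algebra A
    by (rule assms)
  have sub: "closed_subspace A J"
    and ideal: "\<And>a j. a \<in> carrier A \<Longrightarrow> j \<in> J \<Longrightarrow> a \<otimes>\<^bsub>A\<^esub> j \<in> J"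
    using assms(2) by (auto simp: closed_ideal_def)
  have JA: "J \<subseteq> carrier A"
    using sub A.submoduleE(1) by (auto simp: closed_subspace_def)
  interpret J: complex_banach_space "A\<lparr>carrier := J\<rparr>"
    by (rule A.closed_subspace_complex_banach_space[OF sub])
  show ?thesis
    using JA ideal by unfold_locales
      (auto simp: subset_iff A.mult_assoc A.mult_distrib_right A.mult_distrib_left
        A.mult_smult_left A.mult_smult_right A.norm_mult)
qed

lemma banach_left_module_restrict:
  assumes "banach_left_module A E" "closed_ideal A J"
  shows "banach_left_module (A\<lparr>carrier := J\<rparr>) E"
proof -
  interpret E: banach_left_module A E
    by (rule assms)
  interpret J: complex_banach_algebra "A\<lparr>carrier := J\<rparr>"
    by (rule closed_ideal_complex_banach_algebra[OF E.alg.complex_banach_algebra_axioms assms(2)])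
  have JA: "J \<subseteq> carrier A"
    using assms(2) E.alg.submoduleE(1) by (auto simp: closed_ideal_def closed_subspace_def)
  obtain C where "\<forall>a\<in>carrier A. \<forall>x\<in>carrier E. \<parallel>a \<cdot>\<^bsub>E\<^esub> x\<parallel>\<^bsub>E\<^esub> \<le> C * \<parallel>a\<parallel>\<^bsub>A\<^esub> * \<parallel>x\<parallel>\<^bsub>E\<^esub>"
    using E.act_bounded by blast
  then show ?thesis
    using JA by unfold_locales
      (auto simp: subset_iff E.act_closed E.act_add_left E.act_add_right E.act_smult_left
        E.act_smult_right E.act_mult intro!: exI[of _ C])
qed

section \<open>Injectivity: from the ideal up to the algebra\<close>

lemma phi_injectiveE:
  fixes A :: "'a cnormed" and E :: "('a, 'e) left_module" and F K :: "('a, 'u) left_module"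
  assumes "phi_injective TYPE('u) A \<phi> E" "banach_left_module A F" "banach_left_module A K"
    "T \<in> bounded_module_maps A F K" "inj_on T (carrier F)" "admissible F K T"
    "char_span A \<phi> K \<subseteq> T ` carrier F" "Q \<in> bounded_module_maps A F E"
  obtains R where "R \<in> bounded_module_maps A K E" "\<And>x. x \<in> carrier F \<Longrightarrow> R (T x) = Q x"
proof -
  have "\<exists>R\<in>bounded_module_maps A K E. \<forall>x\<in>carrier F. R (T x) = Q x"
    using assms(1)[unfolded phi_injective_def, THEN conjunct2,
        THEN spec[of _ F], THEN spec[of _ K], THEN spec[of _ T]] assms(2-8) by simp
  then show thesis
    using that by blast
qed

lemma phi_injective_of_restrict:
  fixes A :: "'a cnormed" and E :: "('a, 'e) left_module"
  assumes E: "banach_left_module A E" and J: "closed_ideal A J"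
    and inj: "phi_injective TYPE('u) (A\<lparr>carrier := J\<rparr>) (restrict \<phi> J) E"
    and faithful: "faithful_module (A\<lparr>carrier := J\<rparr>) E"
  shows "phi_injective TYPE('u) A \<phi> E"
  unfolding phi_injective_def
proof (intro conjI E allI impI ballI)
  fix F K :: "('a, 'u) left_module" and T Q
  assume F: "banach_left_module A F" and K: "banach_left_module A K"
    and T: "T \<in> bounded_module_maps A F K" "inj_on T (carrier F)" "admissible F K T"
    and span: "char_span A \<phi> K \<subseteq> T ` carrier F"
    and Q: "Q \<in> bounded_module_maps A F E"
  interpret E: banach_left_module A E
    by (rule E)
  interpret K: banach_left_module A K
    by (rule K)
  have JA: "J \<subseteq> carrier A"
    and ideal: "\<And>a j. a \<in> carrier A \<Longrightarrow> j \<in> J \<Longrightarrow> j \<otimes>\<^bsub>A\<^esub> a \<in> J"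
    using J E.alg.submoduleE(1) by (auto simp: closed_ideal_def closed_subspace_def)
  have maps: "bounded_module_maps A F N \<subseteq> bounded_module_maps (A\<lparr>carrier := J\<rparr>) F N"
    for N :: "('a, 'w, 'n) left_module_scheme"
    using JA by (auto simp: bounded_module_maps_def)
  \<comment> \<open>The generators over \<open>J\<close> are among those over \<open>A\<close>, so
    the range condition over \<open>A\<close> is the stronger one.\<close>
  have "char_span (A\<lparr>carrier := J\<rparr>) (restrict \<phi> J) K \<subseteq> char_span A \<phi> K"
    unfolding char_span_def using JA by (intro hull_mono) force
  with span have "char_span (A\<lparr>carrier := J\<rparr>) (restrict \<phi> J) K \<subseteq> T ` carrier F"
    by blast
  then obtain R where R: "R \<in> bounded_module_maps (A\<lparr>carrier := J\<rparr>) K E"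
    and RT: "\<And>x. x \<in> carrier F \<Longrightarrow> R (T x) = Q x"
    using phi_injectiveE[OF inj banach_left_module_restrict[OF F J]
        banach_left_module_restrict[OF K J] subsetD[OF maps T(1)] T(2,3) _ subsetD[OF maps Q]]
    by metis
  have R_closed: "R x \<in> carrier E" if "x \<in> carrier K" for x
    using R that by (auto simp: bounded_module_maps_def bounded_linear_maps_def)
  have R_act: "R (j \<cdot>\<^bsub>K\<^esub> x) = j \<cdot>\<^bsub>E\<^esub> R x" if "j \<in> J" "x \<in> carrier K" for j x
    using R that by (simp add: bounded_module_maps_def)
  have "R (a \<cdot>\<^bsub>K\<^esub> x) = a \<cdot>\<^bsub>E\<^esub> R x" if a: "a \<in> carrier A" and x: "x \<in> carrier K" for a x
  proof -
    \<comment> \<open>These are the two sides of \<open>A\<close>-linearity; every element of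
      \<open>J\<close> will be shown to annihilate their difference.\<close>
    define u v where "u = R (a \<cdot>\<^bsub>K\<^esub> x)" and "v = a \<cdot>\<^bsub>E\<^esub> R x"
    have uv: "u \<in> carrier E" "v \<in> carrier E"
      using a x by (simp_all add: u_def v_def R_closed K.act_closed E.act_closed)
    have "j \<cdot>\<^bsub>E\<^esub> (u \<ominus>\<^bsub>E\<^esub> v) = \<zero>\<^bsub>E\<^esub>" if j: "j \<in> J" for j
    proof -
      have jA: "j \<in> carrier A"
        using j JA by blast
      have "j \<cdot>\<^bsub>E\<^esub> u = R ((j \<otimes>\<^bsub>A\<^esub> a) \<cdot>\<^bsub>K\<^esub> x)"
        using a x j jA by (simp add: u_def R_act K.act_closed K.act_mult)
      \<comment> \<open>Since \<open>J\<close> absorbs factors from the right,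
        \<open>j \<otimes> a\<close> lies in \<open>J\<close>, and \<open>R\<close> commutes with
        its action.\<close>
      also have "\<dots> = j \<cdot>\<^bsub>E\<^esub> v"
        using a x j jA by (simp add: v_def R_act ideal R_closed E.act_mult)
      finally have "j \<cdot>\<^bsub>E\<^esub> u = j \<cdot>\<^bsub>E\<^esub> v" .
      \<comment> \<open>The module laws speak of sums and scalar multiples only, so the difference
        is rewritten in these terms before \<open>j\<close> acts on it.\<close>
      moreover have "u \<ominus>\<^bsub>E\<^esub> v = u \<oplus>\<^bsub>E\<^esub> (-1) \<odot>\<^bsub>E\<^esub> v"
        using uv by (simp add: a_minus_def E.smult_minus_one)
      ultimately show ?thesis
        using jA uv E.act_closed[OF jA] E.smult_minus_one[of v] E.smult_minus_one[of "j \<cdot>\<^bsub>E\<^esub> v"]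
          E.act_add_right[OF jA, of u "\<ominus>\<^bsub>E\<^esub> v"] E.act_smult_right[OF jA, of v "-1"]
        by (simp add: E.M.r_neg)
    qed
    then have "u \<ominus>\<^bsub>E\<^esub> v = \<zero>\<^bsub>E\<^esub>"
      using faithful uv unfolding faithful_module_def by simp
    then show ?thesis
      using uv E.minus_eq_zero_iff by (simp add: u_def v_def)
  qed
  with R have "R \<in> bounded_module_maps A K E"
    by (simp add: bounded_module_maps_def)
  with RT show "\<exists>R\<in>bounded_module_maps A K E. \<forall>x\<in>carrier F. R (T x) = Q x"
    by blast
qed

section \<open>Ideals with an identity: from the algebra down to the ideal\<close>

text \<open>The last claim holds because \<open>a \<otimes> e\<close> lies in the ideal, on which
  \<open>e\<close> is a left identity.\<close>

lemma closed_ideal_identity: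
  assumes "complex_banach_algebra A" "closed_ideal A J" "is_identity (A\<lparr>carrier := J\<rparr>) e"
  shows "e \<in> J" "J \<subseteq> carrier A"
    and "\<And>j. j \<in> J \<Longrightarrow> e \<otimes>\<^bsub>A\<^esub> j = j" "\<And>j. j \<in> J \<Longrightarrow> j \<otimes>\<^bsub>A\<^esub> e = j"
    and "\<And>a. a \<in> carrier A \<Longrightarrow> a \<otimes>\<^bsub>A\<^esub> e \<in> J"
    and "\<And>a. a \<in> carrier A \<Longrightarrow> e \<otimes>\<^bsub>A\<^esub> (a \<otimes>\<^bsub>A\<^esub> e) = a \<otimes>\<^bsub>A\<^esub> e"
proof -
  interpret A: complex_banach_algebra A
    by (rule assms)
  show "e \<in> J" "J \<subseteq> carrier A"
    and "\<And>j. j \<in> J \<Longrightarrow> e \<otimes>\<^bsub>A\<^esub> j = j" "\<And>j. j \<in> J \<Longrightarrow> j \<otimes>\<^bsub>A\<^esub> e = j"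
    and "\<And>a. a \<in> carrier A \<Longrightarrow> a \<otimes>\<^bsub>A\<^esub> e \<in> J"
    and "\<And>a. a \<in> carrier A \<Longrightarrow> e \<otimes>\<^bsub>A\<^esub> (a \<otimes>\<^bsub>A\<^esub> e) = a \<otimes>\<^bsub>A\<^esub> e"
    using assms(2,3) A.submoduleE(1)
    by (auto simp: closed_ideal_def closed_subspace_def is_identity_def)
qed

text \<open>The map sending \<open>a\<close> to \<open>a \<otimes> e\<close> is a bounded algebra
  homomorphism from \<open>A\<close> into \<open>J\<close>, and the new action is the old one pulled
  back along it.\<close>

lemma banach_left_module_extend:
  assumes A: "complex_banach_algebra A" and J: "closed_ideal A J"
    and e: "is_identity (A\<lparr>carrier := J\<rparr>) e"
    and F: "banach_left_module (A\<lparr>carrier := J\<rparr>) F"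
  shows "banach_left_module A (F\<lparr>act := \<lambda>a. act F (a \<otimes>\<^bsub>A\<^esub> e)\<rparr>)"
    (is "banach_left_module A ?F")
proof -
  interpret A: complex_banach_algebra A
    by (rule A)
  interpret F: banach_left_module "A\<lparr>carrier := J\<rparr>" F
    by (rule F)
  interpret F': complex_banach_space ?F
    using F.complex_banach_space_axioms by simp
  note id = closed_ideal_identity[OF A J e]
  have eA: "e \<in> carrier A"
    using id by blast
  \<comment> \<open>Multiplicativity of that map: the inner \<open>e\<close> is absorbed by
    \<open>b \<otimes> e\<close>.\<close>
  have mult: "(a \<otimes>\<^bsub>A\<^esub> b) \<otimes>\<^bsub>A\<^esub> e = (a \<otimes>\<^bsub>A\<^esub> e) \<otimes>\<^bsub>A\<^esub> (b \<otimes>\<^bsub>A\<^esub> e)"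
    if "a \<in> carrier A" "b \<in> carrier A" for a b
    using that eA id(6) by (simp add: A.mult_assoc A.mult_closed)
  obtain C where C: "\<forall>a\<in>J. \<forall>x\<in>carrier F. \<parallel>a \<cdot>\<^bsub>F\<^esub> x\<parallel>\<^bsub>F\<^esub> \<le> C * \<parallel>a\<parallel>\<^bsub>A\<^esub> * \<parallel>x\<parallel>\<^bsub>F\<^esub>"
    using F.act_bounded by auto
  \<comment> \<open>The sign of \<open>C\<close> is unknown; its absolute value makes the
    monotonicity argument valid. The factor \<open>\<parallel>e\<parallel>\<close> bounds
    multiplication by \<open>e\<close>.\<close>
  have bound: "\<parallel>(a \<otimes>\<^bsub>A\<^esub> e) \<cdot>\<^bsub>F\<^esub> x\<parallel>\<^bsub>F\<^esub> \<le> (\<bar>C\<bar> * \<parallel>e\<parallel>\<^bsub>A\<^esub>) * \<parallel>a\<parallel>\<^bsub>A\<^esub> * \<parallel>x\<parallel>\<^bsub>F\<^esub>"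
    if a: "a \<in> carrier A" and x: "x \<in> carrier F" for a x
  proof -
    have "\<parallel>(a \<otimes>\<^bsub>A\<^esub> e) \<cdot>\<^bsub>F\<^esub> x\<parallel>\<^bsub>F\<^esub> \<le> C * (\<parallel>a \<otimes>\<^bsub>A\<^esub> e\<parallel>\<^bsub>A\<^esub> * \<parallel>x\<parallel>\<^bsub>F\<^esub>)"
      using C id(5)[OF a] x by (simp add: mult.assoc)
    also have "\<dots> \<le> \<bar>C\<bar> * (\<parallel>a\<parallel>\<^bsub>A\<^esub> * \<parallel>e\<parallel>\<^bsub>A\<^esub> * \<parallel>x\<parallel>\<^bsub>F\<^esub>)"
      using a x eA
      by (intro mult_mono mult_right_mono A.norm_mult mult_nonneg_nonneg)
        (auto simp: A.norm_nonneg F.norm_nonneg A.mult_closed)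
    finally show ?thesis
      by (simp add: mult_ac)
  qed
  show ?thesis
    using eA id(5) by unfold_locales
      (auto simp: mult A.mult_distrib_right A.mult_smult_left F.act_closed
        F.act_add_left[simplified] F.act_add_right F.act_smult_left[simplified] F.act_smult_right
        F.act_mult[simplified] intro!: exI[of _ "\<bar>C\<bar> * \<parallel>e\<parallel>\<^bsub>A\<^esub>"] bound)
qed

lemma phi_injective_restrict:
  fixes A :: "'a cnormed" and E :: "('a, 'e) left_module"
  assumes E: "banach_left_module A E" and \<phi>: "\<phi> \<in> \<Delta> A" and J: "closed_ideal A J"
    and nz: "\<exists>j\<in>J. \<phi> j \<noteq> 0"
    and e: "is_identity (A\<lparr>carrier := J\<rparr>) e" and unital: "unital_action e E"
    and inj: "phi_injective TYPE('u) A \<phi> E"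
  shows "phi_injective TYPE('u) (A\<lparr>carrier := J\<rparr>) (restrict \<phi> J) E"
  unfolding phi_injective_def
proof (intro conjI banach_left_module_restrict[OF E J] allI impI ballI)
  fix F K :: "('a, 'u) left_module" and T Q
  assume F: "banach_left_module (A\<lparr>carrier := J\<rparr>) F"
    and K: "banach_left_module (A\<lparr>carrier := J\<rparr>) K"
    and T: "T \<in> bounded_module_maps (A\<lparr>carrier := J\<rparr>) F K" "inj_on T (carrier F)" "admissible F K T"
    and span: "char_span (A\<lparr>carrier := J\<rparr>) (restrict \<phi> J) K \<subseteq> T ` carrier F"
    and Q: "Q \<in> bounded_module_maps (A\<lparr>carrier := J\<rparr>) F E"
  interpret E: banach_left_module A E
    by (rule E)
  interpret F: banach_left_module "A\<lparr>carrier := J\<rparr>" F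
    by (rule F)
  have A: "complex_banach_algebra A" ..
  note id = closed_ideal_identity[OF A J e]
  have eA: "e \<in> carrier A"
    using id by blast
  define ext :: "('a, 'u) left_module \<Rightarrow> ('a, 'u) left_module"
    where "ext N = N\<lparr>act := \<lambda>a. act N (a \<otimes>\<^bsub>A\<^esub> e)\<rparr>" for N
  have ext_simps [simp]: "carrier (ext N) = carrier N" "act (ext N) a x = act N (a \<otimes>\<^bsub>A\<^esub> e) x"
    for N a x
    by (simp_all add: ext_def)
  have phi_e: "\<phi> (a \<otimes>\<^bsub>A\<^esub> e) = \<phi> a" if a: "a \<in> carrier A" for a
  proof -
    obtain j where j: "j \<in> J" "\<phi> j \<noteq> 0"
      using nz by blast
    then have "j \<in> carrier A" "e \<otimes>\<^bsub>A\<^esub> j = j"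
      using id(2,3) by auto
    \<comment> \<open>As \<open>\<phi> j\<close> is nonzero, this forces
      \<open>\<phi> e = 1\<close>; here \<phi> being nonzero on the ideal enters.\<close>
    then have "\<phi> e * \<phi> j = \<phi> j"
      using \<phi> eA unfolding characters_def by (metis (mono_tags, lifting) mem_Collect_eq)
    with j show ?thesis
      using \<phi> a eA by (simp add: characters_def)
  qed
  have T': "T \<in> bounded_module_maps A (ext F) (ext K)"
    using T(1) id(5) by (simp add: bounded_module_maps_def ext_def)
  have Q': "Q \<in> bounded_module_maps A (ext F) E"
  proof -
    have "Q ((a \<otimes>\<^bsub>A\<^esub> e) \<cdot>\<^bsub>F\<^esub> x) = a \<cdot>\<^bsub>E\<^esub> Q x" if a: "a \<in> carrier A" and x: "x \<in> carrier F" for a x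
    proof -
      have Qx: "Q x \<in> carrier E"
        using Q x by (auto simp: bounded_module_maps_def bounded_linear_maps_def)
      have "Q ((a \<otimes>\<^bsub>A\<^esub> e) \<cdot>\<^bsub>F\<^esub> x) = (a \<otimes>\<^bsub>A\<^esub> e) \<cdot>\<^bsub>E\<^esub> Q x"
        using Q id(5)[OF a] x by (simp add: bounded_module_maps_def)
      \<comment> \<open>Unitality of \<open>E\<close> removes \<open>e\<close>, so \<open>Q\<close>
        is linear for the original \<open>A\<close>-action on its target.\<close>
      also have "\<dots> = a \<cdot>\<^bsub>E\<^esub> Q x"
        using a eA Qx unital by (simp add: E.act_mult unital_action_def)
      finally show ?thesis .
    qed
    with Q show ?thesis
      by (simp add: bounded_module_maps_def ext_def)
  qed
  have "char_span A \<phi> (ext K) \<subseteq> char_span (A\<lparr>carrier := J\<rparr>) (restrict \<phi> J) K"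
  proof -
    \<comment> \<open>The witnesses are \<open>a \<otimes> e\<close> and \<open>x\<close>; the
      scalar coefficients agree by \<open>phi_e\<close>.\<close>
    have "\<exists>b y. a \<cdot>\<^bsub>ext K\<^esub> x \<ominus>\<^bsub>ext K\<^esub> \<phi> a \<odot>\<^bsub>ext K\<^esub> x
        = b \<cdot>\<^bsub>K\<^esub> y \<ominus>\<^bsub>K\<^esub> restrict \<phi> J b \<odot>\<^bsub>K\<^esub> y \<and> b \<in> J \<and> y \<in> carrier K"
      if "a \<in> carrier A" "x \<in> carrier K" for a x
      using that id(5)[of a] phi_e[of a]
      by (intro exI[of _ "a \<otimes>\<^bsub>A\<^esub> e"] exI[of _ x]) (simp add: ext_def a_minus_def a_inv_def)
    then have "{a \<cdot>\<^bsub>ext K\<^esub> x \<ominus>\<^bsub>ext K\<^esub> \<phi> a \<odot>\<^bsub>ext K\<^esub> x | a x. a \<in> carrier A \<and> x \<in> carrier (ext K)}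
      \<subseteq> {b \<cdot>\<^bsub>K\<^esub> y \<ominus>\<^bsub>K\<^esub> restrict \<phi> J b \<odot>\<^bsub>K\<^esub> y | b y. b \<in> carrier (A\<lparr>carrier := J\<rparr>) \<and> y \<in> carrier K}"
      by (auto simp del: restrict_apply)
    moreover have "submodule H complex_ring (ext K) = submodule H complex_ring K" for H
      by (simp add: ext_def)
    ultimately show ?thesis
      unfolding char_span_def by (simp only: hull_mono)
  qed
  with span have span': "char_span A \<phi> (ext K) \<subseteq> T ` carrier (ext F)"
    by auto
  have F': "banach_left_module A (ext F)" and K': "banach_left_module A (ext K)"
    using banach_left_module_extend[OF A J e] F K by (auto simp: ext_def)
  have "inj_on T (carrier (ext F))" "admissible (ext F) (ext K) T"
    using T(2,3) by (auto simp: ext_def)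
  then obtain R where R: "R \<in> bounded_module_maps A (ext K) E"
    and RT: "\<And>x. x \<in> carrier (ext F) \<Longrightarrow> R (T x) = Q x"
    using phi_injectiveE[OF inj F' K' T' _ _ span' Q'] by metis
  \<comment> \<open>On \<open>J\<close> the extended action is the original one, because
    \<open>j \<otimes> e = j\<close>.\<close>
  have "R (j \<cdot>\<^bsub>K\<^esub> x) = j \<cdot>\<^bsub>E\<^esub> R x" if "j \<in> J" "x \<in> carrier K" for j x
    using R that id(2) id(4)[of j] by (auto simp: bounded_module_maps_def dest!: bspec[of _ _ j])
  with R have "R \<in> bounded_module_maps (A\<lparr>carrier := J\<rparr>) K E"
    by (simp add: bounded_module_maps_def ext_def)
  with RT show "\<exists>R\<in>bounded_module_maps (A\<lparr>carrier := J\<rparr>) K E. \<forall>x\<in>carrier F. R (T x) = Q x"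
    by auto
qed

text \<open>Neither restricting nor extending the action changes the underlying set of a test
  module, so the same universe \<open>'u\<close> serves both sides of each implication.\<close>

theorem theorem2p6:
  fixes A :: "'a cnormed" and E :: "('a, 'e) left_module"
    and \<phi> :: "'a \<Rightarrow> complex" and J :: "'a set"
  assumes "complex_banach_algebra A"
    and "banach_left_module A E"
    and "\<phi> \<in> \<Delta> A"
    and "closed_ideal A J"
    and "\<exists>j\<in>J. \<phi> j \<noteq> 0"
  shows "(\<forall>e\<^sub>J. is_identity (A\<lparr>carrier := J\<rparr>) e\<^sub>J \<longrightarrow> unital_action e\<^sub>J E \<longrightarrow>
            phi_injective TYPE('u) A \<phi> E \<longrightarrow>
            phi_injective TYPE('u) (A\<lparr>carrier := J\<rparr>) (restrict \<phi> J) E)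
       \<and> (phi_injective TYPE('u) (A\<lparr>carrier := J\<rparr>) (restrict \<phi> J) E \<longrightarrow>
            faithful_module (A\<lparr>carrier := J\<rparr>) E \<longrightarrow>
            phi_injective TYPE('u) A \<phi> E)"
proof (intro conjI allI impI)
  fix e\<^sub>J
  assume "is_identity (A\<lparr>carrier := J\<rparr>) e\<^sub>J" "unital_action e\<^sub>J E" "phi_injective TYPE('u) A \<phi> E"
  then show "phi_injective TYPE('u) (A\<lparr>carrier := J\<rparr>) (restrict \<phi> J) E"
    by (rule phi_injective_restrict[OF assms(2-5)])
next
  assume "phi_injective TYPE('u) (A\<lparr>carrier := J\<rparr>) (restrict \<phi> J) E"
    "faithful_module (A\<lparr>carrier := J\<rparr>) E"
  then show "phi_injective TYPE('u) A \<phi> E"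
    by (rule phi_injective_of_restrict[OF assms(2,4)])
qed

end
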